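(* Let $X$ be a valid XDI state machine with set of states $S$, let $h$ be a handshake, let $E$ be an environment, and let $s$ be a state such that $\mathbf{G}_{\mathrm{spec}}(X,h,s,E)$ holds. Let $L$ be a non-empty finite list of states, all of whose members belong to $S$ and are reachable from $s$ relative to $E$, and let $V$ be any finite list of states (the accumulator of visited states). Then the executable checker, called once on the whole list $L$ with accumulator $V$, does not return $\mathrm{nil}$ (i.e. it returns a non-empty list): $\mathrm{Gbs}(V,L)\neq\mathrm{nil}$.
   Context: A valid XDI state machine $X$ consists of a finite set $S$ of states with exactly one initial state $s_{\mathrm{init}}\in S$. Each state has a type, BOX or TRANSIENT, and a finite (ordered) list of transitions $(w,s')$, where $s'\in S$ and the wire $w=(h,k,d)$ consists of a handshake $h$, a kind $k\in\{R,A\}$ (request or acknowledgment) and a direction $d\in\{I,O\}$ (input or output). An environment $E$ is a set of pairs $(h,k)$, the wires deemed stable. A transition labelled $(h,k,d)$ cannot occur if $(h,k)\in E$. $\mathrm{step}_E(s)$ is the list of targets of those transitions of $s$ that can occur. A trace (relative to $E$) is a finite non-empty sequence of states in which each state after the first lies in $\mathrm{step}_E$ of its predecessor (a single state is a trace). A state $s_2$ is reachable from $s_1$ relative to $E$ if there is a trace starting in $s_1$ and ending in $s_2$. Labelling: for a handshake $h$, define $\mathrm{visit}(s,f,r)$, with $f$ a Boolean flag and $r$ an association list from states to Booleans: if $s$ already has an entry in $r$, return $r$; otherwise add the entry $(s,f)$ to $r$ and then, for each transition $(w,s')$ of $s$ in list order, replace $r$ by $\mathrm{visit}(s',f',r)$,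 where $f'=\neg f$ if $w$ is a wire of handshake $h$ and $f'=f$ otherwise; finally return $r$. A state $s$ is called blocking $h$ iff its entry in $\mathrm{visit}(s_{\mathrm{init}},\mathrm{false},\emptyset)$ is true. Specification: $\mathbf{G}_{\mathrm{spec}}(X,h,s,E)$ holds iff every trace (relative to $E$) starting in $s$ ends in a state that is TRANSIENT or blocking $h$. Executable checker (for fixed $X,h,E$), where $V$ is a finite list of visited states, $\mathrm{nil}$ is the empty list, and returning $\mathrm{nil}$ signifies failure. It consists of two mutually recursive procedures, $\mathrm{Gb}$ on a single state and $\mathrm{Gbs}$ on a list of states: - $\mathrm{Gb}(V,s)$: if $s\in V$, return $V$. Otherwise, if $s$ is TRANSIENT or blocking $h$, return $\mathrm{Gbs}(s::V,\ M)$, where $M$ is $\mathrm{step}_E(s)$ with all occurrences of $s$ removed. Otherwise return $\mathrm{nil}$. - $\mathrm{Gbs}(V,L)$: if $L$ is empty, return $V$. Otherwise, with $L=t::L'$, let $r=\mathrm{Gb}(V,t)$; if $r=\mathrm{nil}$ return $\mathrm{nil}$; otherwise let $r'=\mathrm{Gbs}(V,L')$ and return the concatenation of $r$ and $r'$ if $r'\ne\mathrm{nil}$, and $\mathrm{nil}$ otherwise.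
   Formalization: The accumulator V is additionally assumed to be non-empty: for V = nil the claim always fails, since Gbs(nil, nil) = nil forces Gbs(nil, L) = nil for every list L of states. *)

theory Defs
  imports Main
begin

datatype kind = Req | Ack

datatype direction = In | Out

datatype 'h wire = Wire (handshake_of: 'h) (kind_of: kind) (direction_of: direction)

datatype state_type = BOX | TRANSIENT

record ('s, 'h) xdi =
  states :: "'s set"
  init :: 's
  type_of :: "'s \<Rightarrow> state_type"
  transitions :: "'s \<Rightarrow> ('h wire \<times> 's) list"

definition valid_xdi :: "('s, 'h) xdi \<Rightarrow> bool" where
  "valid_xdi X \<longleftrightarrow> finite (states X) \<and> init X \<in> states X \<and>
     (\<forall>s \<in> states X. \<forall>(w, t) \<in> set (transitions X s). t \<in> states X)"

type_synonym 'h environment = "('h \<times> kind) set"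

definition step :: "('s, 'h) xdi \<Rightarrow> 'h environment \<Rightarrow> 's \<Rightarrow> 's list" where
  "step X E s = map snd (filter (\<lambda>(w, t). (handshake_of w, kind_of w) \<notin> E) (transitions X s))"

definition trace :: "('s, 'h) xdi \<Rightarrow> 'h environment \<Rightarrow> 's list \<Rightarrow> bool" where
  "trace X E p \<longleftrightarrow> p \<noteq> [] \<and> set p \<subseteq> states X \<and> successively (\<lambda>a b. b \<in> set (step X E a)) p"

definition reachable :: "('s, 'h) xdi \<Rightarrow> 'h environment \<Rightarrow> 's \<Rightarrow> 's \<Rightarrow> bool" where
  "reachable X E s\<^sub>1 s\<^sub>2 \<longleftrightarrow> (\<exists>p. trace X E p \<and> hd p = s\<^sub>1 \<and> last p = s\<^sub>2)"

text \<open>The labelling and the checker need not terminate on an arbitrary record, whose state set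
  may be infinite. They are therefore introduced as partial functions satisfying their recursion
  equations on the domain of termination, which is shown below to contain all calls on states of a
  valid machine. The function \<open>visits\<close> is the loop over the transition list of a state with
  flag \<open>f\<close>.\<close>

function (domintros) visit ::
    "('s, 'h) xdi \<Rightarrow> 'h \<Rightarrow> 's \<Rightarrow> bool \<Rightarrow> ('s \<times> bool) list \<Rightarrow> ('s \<times> bool) list"
  and visits ::
    "('s, 'h) xdi \<Rightarrow> 'h \<Rightarrow> ('h wire \<times> 's) list \<Rightarrow> bool \<Rightarrow> ('s \<times> bool) list \<Rightarrow> ('s \<times> bool) list"
  where
  "visit X h s f r =
     (if s \<in> fst ` set r then r else visits X h (transitions X s) f ((s, f) # r))"
| "visits X h [] f r = r"
| "visits X h ((w, t) # ts) f r =
     visits X h ts f (visit X h t (if handshake_of w = h then \<not> f else f) r)"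
  by pat_completeness auto

definition blocking :: "('s, 'h) xdi \<Rightarrow> 'h \<Rightarrow> 's \<Rightarrow> bool" where
  "blocking X h s \<longleftrightarrow> map_of (visit X h (init X) False []) s = Some True"

definition G_spec :: "('s, 'h) xdi \<Rightarrow> 'h \<Rightarrow> 's \<Rightarrow> 'h environment \<Rightarrow> bool" where
  "G_spec X h s E \<longleftrightarrow>
     (\<forall>p. trace X E p \<and> hd p = s \<longrightarrow> type_of X (last p) = TRANSIENT \<or> blocking X h (last p))"

function (domintros) Gb :: "('s, 'h) xdi \<Rightarrow> 'h \<Rightarrow> 'h environment \<Rightarrow> 's list \<Rightarrow> 's \<Rightarrow> 's list"
  and Gbs :: "('s, 'h) xdi \<Rightarrow> 'h \<Rightarrow> 'h environment \<Rightarrow> 's list \<Rightarrow> 's list \<Rightarrow> 's list"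
  where
  "Gb X h E V s =
     (if s \<in> set V then V
      else if type_of X s = TRANSIENT \<or> blocking X h s
        then Gbs X h E (s # V) (removeAll s (step X E s))
      else [])"
| "Gbs X h E V [] = V"
| "Gbs X h E V (t # L) =
     (let r = Gb X h E V t in
      if r = [] then []
      else let r' = Gbs X h E V L in if r' \<noteq> [] then r @ r' else [])"
  by pat_completeness auto

lemma visit_visits_dom:
  assumes X: "valid_xdi X"
  shows "s \<in> states X \<Longrightarrow> visit_visits_dom (Inl (X, h, s, f, r))"
    and "snd ` set ts \<subseteq> states X \<Longrightarrow> visit_visits_dom (Inr (X, h, ts, f, r))"
proof -
  let ?keys = "\<lambda>r :: ('a \<times> bool) list. fst ` set r"
  let ?A = "\<lambda>s f r. visit_visits_dom (Inl (X, h, s, f, r)) \<and> ?keys r \<subseteq> ?keys (visit X h s f r)"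
  let ?B = "\<lambda>ts f r. visit_visits_dom (Inr (X, h, ts, f, r)) \<and> ?keys r \<subseteq> ?keys (visits X h ts f r)"
  have fin: "finite (states X)"
    and closed: "s \<in> states X \<Longrightarrow> snd ` set (transitions X s) \<subseteq> states X" for s
    using X by (auto simp: valid_xdi_def split_beta)
  have main: "(\<forall>s f r. s \<in> states X \<longrightarrow> card (states X - ?keys r) \<le> n \<longrightarrow> ?A s f r) \<and>
      (\<forall>ts f r. snd ` set ts \<subseteq> states X \<longrightarrow> card (states X - ?keys r) \<le> n \<longrightarrow> ?B ts f r)" for n
  proof (induction n rule: less_induct)
    case (less n)
    have A: "?A s f r" if s: "s \<in> states X" and r: "card (states X - ?keys r) \<le> n" for s f r
    proof (cases "s \<in> ?keys r")
      case True
      then have "visit_visits_dom (Inl (X, h, s, f, r))"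
        by (auto intro: visit_visits.domintros(1))
      with True show ?thesis
        by (simp add: visit.psimps)
    next
      case False
      have "card (states X - ?keys ((s, f) # r)) < card (states X - ?keys r)"
        using s False fin by (intro psubset_card_mono) auto
      with r have less_n: "card (states X - ?keys ((s, f) # r)) < n"
        by linarith
      have B: "?B (transitions X s) f ((s, f) # r)"
        by (rule less.IH[OF less_n, THEN conjunct2, rule_format, OF closed[OF s] order_refl])
      then have dom: "visit_visits_dom (Inl (X, h, s, f, r))"
        by (auto intro: visit_visits.domintros(1))
      with B False show ?thesis
        by (simp add: visit.psimps)
    qed
    have "?B ts f r" if "snd ` set ts \<subseteq> states X" and "card (states X - ?keys r) \<le> n" for ts f r
      using that
    proof (induction ts arbitrary: r)
      case Nil
      have "visit_visits_dom (Inr (X, h, [], f, r))"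
        by (rule visit_visits.domintros)
      then show ?case
        by (simp add: visits.psimps)
    next
      case (Cons a ts)
      obtain w t where a: "a = (w, t)"
        by fastforce
      let ?f = "if handshake_of w = h then \<not> f else f"
      let ?r = "visit X h t ?f r"
      have t: "t \<in> states X" and ts: "snd ` set ts \<subseteq> states X"
        using Cons.prems a by auto
      from A[OF t Cons.prems(2), of ?f] have At: "?A t ?f r" .
      then have "card (states X - ?keys ?r) \<le> card (states X - ?keys r)"
        using fin by (intro card_mono Diff_mono) simp_all
      with Cons.prems(2) have "card (states X - ?keys ?r) \<le> n"
        by linarith
      from Cons.IH[OF ts this] have Bt: "?B ts f ?r" .
      have dom: "visit_visits_dom (Inr (X, h, (w, t) # ts, f, r))"
        by (rule visit_visits.domintros) (use At Bt in \<open>simp_all split: if_splits\<close>)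
      have "visits X h ((w, t) # ts) f r = visits X h ts f ?r"
        using dom by (rule visits.psimps)
      moreover have "?keys r \<subseteq> ?keys (visits X h ts f ?r)"
        using At[THEN conjunct2] Bt[THEN conjunct2] by (rule order_trans)
      ultimately show ?case
        unfolding a using dom by (simp only: simp_thms)
    qed
    with A show ?case
      by (intro conjI allI impI) simp_all
  qed
  show "s \<in> states X \<Longrightarrow> visit_visits_dom (Inl (X, h, s, f, r))"
    and "snd ` set ts \<subseteq> states X \<Longrightarrow> visit_visits_dom (Inr (X, h, ts, f, r))"
    using main[of "card (states X - ?keys r)"] by simp_all
qed

lemma Gb_Gbs_dom:
  assumes X: "valid_xdi X"
  shows "s \<in> states X \<Longrightarrow> Gb_Gbs_dom (Inl (X, h, E, V, s))"
    and "set L \<subseteq> states X \<Longrightarrow> Gb_Gbs_dom (Inr (X, h, E, V, L))"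
proof -
  have fin: "finite (states X)"
    and closed: "s \<in> states X \<Longrightarrow> set (step X E s) \<subseteq> states X" for s
    using X by (auto simp: valid_xdi_def step_def split_beta)
  have main: "(\<forall>s V. s \<in> states X \<longrightarrow> card (states X - set V) \<le> n \<longrightarrow>
        Gb_Gbs_dom (Inl (X, h, E, V, s))) \<and>
      (\<forall>L V. set L \<subseteq> states X \<longrightarrow> card (states X - set V) \<le> n \<longrightarrow>
        Gb_Gbs_dom (Inr (X, h, E, V, L)))" for n
  proof (induction n rule: less_induct)
    case (less n)
    have A: "Gb_Gbs_dom (Inl (X, h, E, V, s))"
      if s: "s \<in> states X" and V: "card (states X - set V) \<le> n" for s V
    proof (cases "s \<in> set V")
      case True
      then show ?thesis
        by (auto intro: Gb_Gbs.domintros(1))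
    next
      case False
      have "card (states X - set (s # V)) < card (states X - set V)"
        using s False fin by (intro psubset_card_mono) auto
      with V have less_n: "card (states X - set (s # V)) < n"
        by linarith
      have closed':  "set (removeAll s (step X E s)) \<subseteq> states X"
        using closed[OF s] by auto
      have "Gb_Gbs_dom (Inr (X, h, E, s # V, removeAll s (step X E s)))"
        by (rule less.IH[OF less_n, THEN conjunct2, rule_format, OF closed' order_refl])
      then show ?thesis
        by (auto intro: Gb_Gbs.domintros(1))
    qed
    have "Gb_Gbs_dom (Inr (X, h, E, V, L))"
      if "set L \<subseteq> states X" and "card (states X - set V) \<le> n" for L V
      using that(1)
    proof (induction L)
      case Nil
      show ?case
        by (rule Gb_Gbs.domintros)
    next
      case (Cons t L)
      then show ?case
        using A[of t V] that(2) by (auto intro: Gb_Gbs.domintros(3))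
    qed
    with A show ?case
      by (intro conjI allI impI) simp_all
  qed
  show "s \<in> states X \<Longrightarrow> Gb_Gbs_dom (Inl (X, h, E, V, s))"
    and "set L \<subseteq> states X \<Longrightarrow> Gb_Gbs_dom (Inr (X, h, E, V, L))"
    using main[of "card (states X - set V)"] by simp_all
qed

text \<open>With an empty accumulator the checker fails on every list, whatever the machine, because
  \<open>Gbs\<close> returns its accumulator on the empty list and \<open>[]\<close> signifies failure.\<close>

lemma Gbs_Nil_accumulator:
  assumes "valid_xdi X" and "set L \<subseteq> states X"
  shows "Gbs X h E [] L = []"
  using assms(2)
proof (induction L)
  case Nil
  show ?case
    using Gb_Gbs_dom(2)[OF assms(1)] by (simp add: Gbs.psimps)
next
  case (Cons t L)
  then show ?case
    using Gb_Gbs_dom(2)[OF assms(1) Cons.prems] by (simp add: Gbs.psimps Let_def)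
qed

end

theory Submission
  imports Defs
begin

text \<open>The checker can yield \<open>[]\<close> in two ways: it meets a state neither TRANSIENT
  nor blocking \<open>h\<close>, or it returns an empty accumulator. \<open>G_spec\<close> excludes
  the first on states reachable from \<open>s\<close>, and recursive calls stay among these; the
  second cannot occur once \<open>V\<close> is non-empty, as recursion keeps \<open>V\<close> or
  extends it. \<open>Gb_Gbs_not_Nil\<close> combines both facts by induction along the
  recursion.\<close>

lemma step_in_states:
  assumes "valid_xdi X" and "s \<in> states X" and "t \<in> set (step X E s)"
  shows "t \<in> states X"
  using assms by (fastforce simp: valid_xdi_def step_def)

lemma reachable_step:
  assumes "reachable X E s t" and "u \<in> set (step X E t)" and "u \<in> states X"
  shows "reachable X E s u"
proof -
  from assms(1) obtain p where p: "trace X E p" "hd p = s" "last p = t"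
    by (auto simp: reachable_def)
  then have "trace X E (p @ [u])"
    using assms(2,3) by (auto simp: trace_def successively_append_iff)
  moreover have "hd (p @ [u]) = s"
    using p by (auto simp: trace_def)
  ultimately show ?thesis
    unfolding reachable_def by (metis last_snoc)
qed

lemma G_spec_reachable:
  assumes "G_spec X h s E" and "reachable X E s t"
  shows "type_of X t = TRANSIENT \<or> blocking X h t"
  using assms by (auto simp: G_spec_def reachable_def)

text \<open>The root \<open>s\<close> stays fixed while the current state or list varies, so
  reachability from \<open>s\<close> is the invariant passed to each recursive call.\<close>

lemma Gb_Gbs_not_Nil:
  shows "Gb_Gbs_dom (Inl (X, h, E, V, t)) \<Longrightarrow> valid_xdi X \<Longrightarrow> G_spec X h s E \<Longrightarrow>
      t \<in> states X \<Longrightarrow> reachable X E s t \<Longrightarrow> V \<noteq> [] \<Longrightarrow> Gb X h E V t \<noteq> []"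
    and "Gb_Gbs_dom (Inr (X, h, E, V, L)) \<Longrightarrow> valid_xdi X \<Longrightarrow> G_spec X h s E \<Longrightarrow>
      \<forall>t \<in> set L. t \<in> states X \<and> reachable X E s t \<Longrightarrow> V \<noteq> [] \<Longrightarrow> Gbs X h E V L \<noteq> []"
proof (induction X h E V t and X h E V L rule: Gb_Gbs.pinduct)
  case (1 X h E V t)
  then show ?case
    \<comment> \<open>A visited \<open>t\<close> returns \<open>V\<close> itself; otherwise the
      failing branch contradicts \<open>G_spec\<close>, and the successors of \<open>t\<close>
      inherit the invariant.\<close>
    by (auto simp: Gb.psimps dest: G_spec_reachable step_in_states reachable_step)
next
  case (2 X h E V)
  then show ?case
    by (simp add: Gbs.psimps)
next
  \<comment> \<open>Head and tail are checked with the same \<open>V\<close>, so both induction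
    hypotheses apply.\<close>
  case (3 X h E V t L)
  then show ?case
    by (simp add: Gbs.psimps Let_def)
qed

theorem lemma2:
  fixes X :: "('s, 'h) xdi" and h :: 'h and E :: "'h environment"
    and s :: 's and L V :: "'s list"
  assumes "valid_xdi X"
    and "s \<in> states X"
    and "G_spec X h s E"
    and "L \<noteq> []"
    and "\<forall>t \<in> set L. t \<in> states X \<and> reachable X E s t"
    and "set V \<subseteq> states X"
    and "V \<noteq> []"
  shows "Gbs X h E V L \<noteq> []"
proof (rule Gb_Gbs_not_Nil(2))
  show "Gb_Gbs_dom (Inr (X, h, E, V, L))"
    using assms(1,5) by (intro Gb_Gbs_dom(2)) auto
qed (use assms in auto)

end
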